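(* Let $(X,d)$ be a metric space and let $\Phi:X\to\mathbb R\cup\{+\infty\}$ be a proper functional bounded from below. Assume that there exists an upper gradient $g:X\to\mathbb R\cup\{+\infty\}$ of $\Phi$ such that $\mathcal M(g)\neq\emptyset$. Let $u\in\mathcal M(g)$ and $\varepsilon>0$ be such that $$\Phi(u)\le\inf_X\Phi+\varepsilon\qquad\text{and}\qquad g(u)\le\liminf_{v\to u}g(v).$$ Then for any $\lambda>0$ there exists $\hat u\in\mathcal M(g)$ such that (a) $d(u,\hat u)\le\lambda$; (b) $\Phi(\hat u)+\frac{\varepsilon}{\lambda}d(u,\hat u)\le\Phi(u)$; (c) $g(\hat u)\le\varepsilon/\lambda$.
   Context: Notation: $\operatorname{dom}\Phi=\{u\in X:\Phi(u)<+\infty\}$; proper means $\operatorname{dom}\Phi\ne\emptyset$. The metric space is not assumed complete. Locally absolutely continuous curve: a curve $v:(0,+\infty)\to X$ for which there is a nonnegative $m\in L^1_{\mathrm{loc}}(0,+\infty)$ with $d(v(t),v(s))\le\int_s^t m(r)\,dr$ for all $0<s\le t$. For such a curve the metric derivative $|\dot v|(t):=\lim_{h\to0}\frac{d(v(t+h),v(t))}{|h|}$ exists for a.e. $t$ and belongs to $L^1_{\mathrm{loc}}(0,+\infty)$. (Strong) upper gradient of $\Phi$: a nonnegative function $g:X\to\mathbb R\cup\{+\infty\}$ such that for every locally absolutely continuous curve $v:(0,+\infty)\to X$ with values in $\operatorname{dom}\Phi$, the function $g\circ v$ is Borel measurable and $|\Phi(v(t))-\Phi(v(s))|\le\int_s^t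 g(v(r))\,|\dot v|(r)\,dr$ for all $0<s\le t$ (the right-hand side may be $+\infty$). "Upper gradient" always means strong upper gradient. Gradient flow of $\Phi$ with respect to an upper gradient $g$: a locally absolutely continuous curve $v:(0,+\infty)\to X$ such that (1) $v(t)\in\operatorname{dom}\Phi$ for all $t>0$; (2) $\Phi(v(t))-\Phi(v(s))\le-\frac12\int_s^t|\dot v|(r)^2\,dr-\frac12\int_s^t g(v(r))^2\,dr$ for all $s,t\in(0,+\infty)$ (integrals are oriented). $\mathcal M(g)$ is the set of all $u\in\operatorname{dom}\Phi$ for which there exists a gradient flow $v:(0,+\infty)\to X$ of $\Phi$ with respect to $g$ with $\lim_{t\to0^+}v(t)=u$ and $\lim_{t\to0^+}\Phi(v(t))=\Phi(u)$. *)

theory Defs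
  imports "HOL-Analysis.Analysis"
begin

(* Functionals X -> R \<union> {+\<infinity>} are ereal-valued functions that avoid -\<infinity>; nonnegative functions
   X -> R \<union> {+\<infinity>} are ennreal-valued functions.  Curves (0,+\<infinity>) -> X are total functions on
   the reals of which only the values at positive arguments are ever used. *)

definition eff_dom :: "('a \<Rightarrow> ereal) \<Rightarrow> 'a set" where
  "eff_dom \<Phi> = {u. \<Phi> u < \<infinity>}"

definition proper_functional :: "('a \<Rightarrow> ereal) \<Rightarrow> bool" where
  "proper_functional \<Phi> \<longleftrightarrow> (\<forall>x. \<Phi> x \<noteq> -\<infinity>) \<and> eff_dom \<Phi> \<noteq> {}"

definition bounded_from_below :: "('a \<Rightarrow> ereal) \<Rightarrow> bool" where
  "bounded_from_below \<Phi> \<longleftrightarrow> (\<exists>c::real. \<forall>x. ereal c \<le> \<Phi> x)"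

definition locally_ac_curve :: "(real \<Rightarrow> 'a::metric_space) \<Rightarrow> bool" where
  "locally_ac_curve v \<longleftrightarrow>
     (\<exists>m::real \<Rightarrow> real.
        (\<forall>r>0. 0 \<le> m r) \<and>
        (\<forall>a b. 0 < a \<longrightarrow> a \<le> b \<longrightarrow> set_integrable lborel {a..b} m) \<and>
        (\<forall>s t. 0 < s \<longrightarrow> s \<le> t \<longrightarrow> dist (v t) (v s) \<le> (LINT r:{s..t}|lborel. m r)))"

(* Lim is unspecified where the limit does not exist; for a locally absolutely continuous
   curve these times form a null set in (0,+\<infinity>), so they do not affect the integrals below. *)
definition metric_deriv :: "(real \<Rightarrow> 'a::metric_space) \<Rightarrow> real \<Rightarrow> real" where
  "metric_deriv v t = Lim (at 0) (\<lambda>h. dist (v (t + h)) (v t) / \<bar>h\<bar>)"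

(* The product in the integrand uses the convention 0 * \<infinity> = 0. *)
definition upper_gradient :: "('a::metric_space \<Rightarrow> ereal) \<Rightarrow> ('a \<Rightarrow> ennreal) \<Rightarrow> bool" where
  "upper_gradient \<Phi> g \<longleftrightarrow>
     (\<forall>v. locally_ac_curve v \<longrightarrow> (\<forall>t>0. v t \<in> eff_dom \<Phi>) \<longrightarrow>
        (\<lambda>r. g (v r)) \<in> borel_measurable (restrict_space borel {0<..}) \<and>
        (\<forall>s t. 0 < s \<longrightarrow> s \<le> t \<longrightarrow>
           \<bar>\<Phi> (v t) - \<Phi> (v s)\<bar>
             \<le> enn2ereal (\<integral>\<^sup>+ r\<in>{s..t}. g (v r) * ennreal (metric_deriv v r) \<partial>lborel)))"

(* Integral from s to t of a nonnegative function, with the sign reversed for t < s.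
   Unlike interval_lebesgue_integral it takes infinite values instead of defaulting to 0. *)
definition oriented_nn_integral :: "real \<Rightarrow> real \<Rightarrow> (real \<Rightarrow> ennreal) \<Rightarrow> ereal" where
  "oriented_nn_integral s t f =
     (if s \<le> t then enn2ereal (\<integral>\<^sup>+ r\<in>{s..t}. f r \<partial>lborel)
      else - enn2ereal (\<integral>\<^sup>+ r\<in>{t..s}. f r \<partial>lborel))"

definition gradient_flow ::
    "('a::metric_space \<Rightarrow> ereal) \<Rightarrow> ('a \<Rightarrow> ennreal) \<Rightarrow> (real \<Rightarrow> 'a) \<Rightarrow> bool" where
  "gradient_flow \<Phi> g v \<longleftrightarrow>
     locally_ac_curve v \<and>
     (\<forall>t>0. v t \<in> eff_dom \<Phi>) \<and>
     (\<forall>s t. 0 < s \<longrightarrow> 0 < t \<longrightarrow>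
        \<Phi> (v t) - \<Phi> (v s)
          \<le> - (ereal (1/2) * oriented_nn_integral s t (\<lambda>r. (ennreal (metric_deriv v r))\<^sup>2))
             - ereal (1/2) * oriented_nn_integral s t (\<lambda>r. (g (v r))\<^sup>2))"

definition flow_starts :: "('a::metric_space \<Rightarrow> ereal) \<Rightarrow> ('a \<Rightarrow> ennreal) \<Rightarrow> 'a set" where
  "flow_starts \<Phi> g =
     {u \<in> eff_dom \<Phi>. \<exists>v. gradient_flow \<Phi> g v \<and>
        (v \<longlongrightarrow> u) (at_right 0) \<and> ((\<lambda>t. \<Phi> (v t)) \<longlongrightarrow> \<Phi> u) (at_right 0)}"

end

theory Submission imports Defs begin

text \<open>
  Put \<open>c = \<epsilon> / \<lambda>\<close> and follow the gradient flow \<open>v\<close> starting at \<open>u\<close>. If \<open>g u \<le> c\<close>, the point \<open>u\<close> itself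
  will do. Otherwise semicontinuity at \<open>u\<close> gives \<open>g (v t) > c\<close> for small \<open>t\<close>, and this cannot persist for
  all \<open>t\<close> since \<open>\<Phi>\<close> is bounded below; let \<open>T > 0\<close> be the infimum of the times with \<open>g (v t) \<le> c\<close>. As \<open>g\<close> need
  not be semicontinuous at \<open>v T\<close>, the infimum may not be attained. But up to time \<open>T\<close> we have
  \<open>|v'|\<^sup>2/2 + g\<^sup>2/2 > c |v'|\<close>, so that \<open>\<Phi> (v T) + c d(u, v T) < \<Phi> u\<close> with strict inequality, and by
  continuity of \<open>v\<close> and monotonicity of \<open>\<Phi>\<close> along \<open>v\<close> the non-strict inequality survives at some \<open>t \<ge> T\<close>
  with \<open>g (v t) \<le> c\<close>. The tail of \<open>v\<close> is a gradient flow starting at \<open>v t\<close>.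

  The estimate \<open>d(v s, v t) \<le> \<integral> |v'|\<close> requires the a.e. existence of the metric derivative: it is the
  supremum over rational \<open>q\<close> of \<open>|k q|\<close>, where \<open>k q\<close> is the density of the absolutely continuous real
  function \<open>t \<mapsto> d(v t, v q)\<close>.
\<close>

subsection \<open>Lebesgue differentiation on the real line\<close>

lemma set_integrable_lborel:
  fixes f :: "real \<Rightarrow> real"
  assumes "integrable lborel f" and "S \<in> sets borel"
  shows "set_integrable lborel S f"
  using assms integrable_mult_indicator[of S lborel f] by (simp add: set_integrable_def)

text \<open>The point \<open>a\<close> carries no mass, so half-open and closed intervals have the
  same integral. This makes every interval integral an increment of one global primitive, the form
  in which integral bounds are used below.\<close>

lemma LINT_atMost_diff:
  fixes f :: "real \<Rightarrow> real"
  assumes f: "integrable lborel f" and "a \<le> b"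
  shows "(LINT r:{..b}|lborel. f r) - (LINT r:{..a}|lborel. f r) = (LINT r:{a..b}|lborel. f r)"
proof -
  have "(LINT r:{..b}|lborel. f r) = (LINT r:{..a} \<union> {a<..b}|lborel. f r)"
    using \<open>a \<le> b\<close> by (intro arg_cong[where f="\<lambda>S. set_lebesgue_integral lborel S f"]) auto
  also have "\<dots> = (LINT r:{..a}|lborel. f r) + (LINT r:{a<..b}|lborel. f r)"
    by (intro set_integral_Un set_integrable_lborel f) auto
  also have "(LINT r:{a<..b}|lborel. f r) = (LINT r:{a..b}|lborel. f r)"
    unfolding set_lebesgue_integral_def
    using AE_lborel_singleton[of a] f
    by (intro integral_cong_AE) (auto simp: indicator_def elim!: eventually_mono)
  finally show ?thesis by simp
qed

lemma LINT_eq_HK: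
  fixes f :: "real \<Rightarrow> real"
  assumes f: "integrable lborel f"
  shows "(LINT r:{a..b}|lborel. f r) = integral {a..b} f"
  using set_borel_integral_eq_integral(2)[OF set_integrable_lborel[OF f]] by simp

lemma isCont_LINT_atMost:
  fixes f :: "real \<Rightarrow> real"
  assumes f: "integrable lborel f"
  shows "isCont (\<lambda>x. LINT r:{..x}|lborel. f r) x"
proof -
  define G where "G = (\<lambda>x. LINT r:{..x}|lborel. f r)"
  have "continuous_on {x-1..x+1} (\<lambda>y. integral {x-1..y} f)"
    using set_borel_integral_eq_integral(1)[OF set_integrable_lborel[OF f, of "{x-1..x+1}"]]
    by (intro indefinite_integral_continuous_1) auto
  then have "continuous_on {x-1..x+1} (\<lambda>y. integral {x-1..y} f + G (x-1))"
    by (intro continuous_intros)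
  then have "continuous_on {x-1..x+1} G"
  proof (rule continuous_on_eq)
    fix y assume "y \<in> {x-1..x+1}"
    then show "integral {x-1..y} f + G (x-1) = G y"
      using LINT_atMost_diff[OF f, of "x-1" y] LINT_eq_HK[OF f, of "x-1" y] by (simp add: G_def)
  qed
  then show ?thesis
    unfolding G_def by (rule continuous_on_interior) auto
qed

lemma isCont_if_dist_le:
  fixes f :: "'a::metric_space \<Rightarrow> 'b::metric_space" and G :: "'a \<Rightarrow> real"
  assumes "\<And>y. dist (f y) (f x) \<le> \<bar>G y - G x\<bar>" and "isCont G x"
  shows "isCont f x"
  using assms unfolding continuous_at_eps_delta dist_real_def by (meson le_less_trans)

text \<open>Specialises the differentiation theorem for cubes with lower corner \<open>x\<close>. In
  dimension one these are the intervals \<open>{x..x+h}\<close>, so only averages to the right are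
  controlled.\<close>

lemma integral_averages_AE:
  fixes f :: "real \<Rightarrow> real"
  assumes f: "integrable lborel f"
  shows "AE x in lborel. \<forall>e>0. \<exists>d>0. \<forall>h. 0 < h \<and> h < d \<longrightarrow>
           \<bar>(LINT r:{x..x+h}|lborel. f r) / h - f x\<bar> < e"
proof -
  have "f integrable_on cbox a b" for a b
    using set_borel_integral_eq_integral(1)[OF set_integrable_lborel[OF f, of "cbox a b"]] by simp
  then obtain N where "negligible N" and
    N: "\<And>x e. x \<notin> N \<Longrightarrow> 0 < e \<Longrightarrow> \<exists>d>0. \<forall>h. 0 < h \<and> h < d \<longrightarrow>
         norm (integral (cbox x (x + h *\<^sub>R One)) f /\<^sub>R h ^ DIM(real) - f x) < e"
    using integrable_ccontinuous_explicit[of f] by metis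
  have "AE x in lebesgue. x \<notin> N"
    using \<open>negligible N\<close> by (simp add: AE_not_in negligible_iff_null_sets)
  then have "AE x in lborel. x \<notin> N"
    by (simp add: AE_completion_iff)
  then show ?thesis
    by eventually_elim (use N in \<open>auto simp: LINT_eq_HK[OF f] divide_inverse mult.commute\<close>)
qed

text \<open>Averages to the right give the right difference quotients. Averages to the right of the
  reflected function at \<open>-x\<close> give the left ones.\<close>

theorem lebesgue_differentiation_real:
  fixes f :: "real \<Rightarrow> real"
  assumes f: "integrable lborel f"
  shows "AE x in lborel. ((\<lambda>y. LINT r:{..y}|lborel. f r) has_real_derivative f x) (at x)"
proof -
  define P where "P = (\<lambda>y. LINT r:{..y}|lborel. f r)"
  have f': "integrable lborel (\<lambda>x. f (- x))"
    using lborel_integrable_real_affine[OF f, of "-1" 0] by simp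
  \<comment> \<open>Lebesgue measure is its own image under \<open>uminus\<close>, so a property
    holding at almost every \<open>x\<close> also holds at \<open>- x\<close> for almost every
    \<open>x\<close>.\<close>
  have "AE x in distr lborel borel uminus. \<forall>e>0. \<exists>d>0. \<forall>h. 0 < h \<and> h < d \<longrightarrow>
           \<bar>(LINT r:{x..x+h}|lborel. f (- r)) / h - f (- x)\<bar> < e"
    unfolding lborel_distr_uminus using integral_averages_AE[OF f'] .
  then have refl: "AE x in lborel. \<forall>e>0. \<exists>d>0. \<forall>h. 0 < h \<and> h < d \<longrightarrow>
           \<bar>(LINT r:{-x..-x+h}|lborel. f (- r)) / h - f x\<bar> < e"
    by (auto dest!: AE_distrD[rotated])
  have R: "(LINT r:{-x..-x+h}|lborel. f (- r)) = P x - P (x - h)" if "h > 0" for x h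
  proof -
    have "{r. - r \<in> {x-h..x}} = {-x..-x+h}" by auto
    then show ?thesis
      using that LINT_atMost_diff[OF f, of "x - h" x] set_integral_reflect[of "{x-h..x}" f]
      by (simp add: P_def)
  qed
  show ?thesis
    using integral_averages_AE[OF f] refl
  proof eventually_elim
    case (elim x)
    show ?case
      unfolding P_def[symmetric] DERIV_def
    proof (rule LIM_I)
      fix e :: real assume "e > 0"
      obtain d1 where d1: "d1 > 0" "\<And>h. 0 < h \<Longrightarrow> h < d1 \<Longrightarrow> \<bar>(P (x + h) - P x) / h - f x\<bar> < e"
        using elim(1)[rule_format, OF \<open>e > 0\<close>] LINT_atMost_diff[OF f, of x] unfolding P_def
        by (metis less_add_same_cancel1 less_imp_le)
      obtain d2 where d2: "d2 > 0" "\<And>h. 0 < h \<Longrightarrow> h < d2 \<Longrightarrow> \<bar>(P x - P (x - h)) / h - f x\<bar> < e"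
        using elim(2)[rule_format, OF \<open>e > 0\<close>] R by metis
      have "norm ((P (x + h) - P x) / h - f x) < e" if "h \<noteq> 0" "norm (h - 0) < min d1 d2" for h
      proof (cases "h > 0")
        case True then show ?thesis using d1 that by simp
      next
        case False
        then show ?thesis using d2(2)[of "-h"] that by (simp add: minus_divide_left)
      qed
      then show "\<exists>s>0. \<forall>h. h \<noteq> 0 \<and> norm (h - 0) < s \<longrightarrow> norm ((P (x + h) - P x) / h - f x) < e"
        using d1(1) d2(1) by (intro exI[of _ "min d1 d2"]) auto
    qed
  qed
qed

subsection \<open>Absolutely continuous real functions\<close>

text \<open>\<open>measure_of\<close> takes the prescribed values only if they are countably
  additive, which here follows by adding two nonnegative series termwise. It serves to evaluate the
  sum of two Stieltjes measures.\<close>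

lemma emeasure_sum_measure:
  assumes [simp]: "sets N = sets M" and A: "A \<in> sets M"
  shows "emeasure (measure_of (space M) (sets M) (\<lambda>A. emeasure M A + emeasure N A)) A
           = emeasure M A + emeasure N A"
proof (rule emeasure_measure_of_sigma)
  show "countably_additive (sets M) (\<lambda>A. emeasure M A + emeasure N A)"
    unfolding countably_additive_def
    by (auto simp: suminf_add[symmetric] suminf_emeasure)
qed (use A in \<open>auto simp: positive_def sets.sigma_algebra_axioms\<close>)

text \<open>Let \<open>G\<close> be the primitive of \<open>m\<close>. The bound on the increments
  makes \<open>F = G + \<phi>\<close> increasing and its Stieltjes measure absolutely continuous.
  Radon-Nikodym provides a density \<open>q\<close>, and subtracting the density \<open>m\<close> of
  \<open>G\<close> leaves that of \<open>\<phi>\<close>.\<close>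

theorem absolutely_continuous_real_integral:
  fixes \<phi> m :: "real \<Rightarrow> real"
  assumes m: "integrable lborel m" and m0: "\<And>r. 0 \<le> m r"
    and \<phi>: "\<And>s t. s \<le> t \<Longrightarrow> \<bar>\<phi> t - \<phi> s\<bar> \<le> (LINT r:{s..t}|lborel. m r)"
  shows "\<exists>k. integrable lborel k \<and> (\<forall>s t. s \<le> t \<longrightarrow> \<phi> t - \<phi> s = (LINT r:{s..t}|lborel. k r))"
proof -
  define G where "G = (\<lambda>x. LINT r:{..x}|lborel. m r)"
  have Gd: "G t - G s = (LINT r:{s..t}|lborel. m r)" if "s \<le> t" for s t
    unfolding G_def using LINT_atMost_diff[OF m that] .
  have bd: "\<bar>\<phi> t - \<phi> s\<bar> \<le> G t - G s" if "s \<le> t" for s t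
    using \<phi>[OF that] Gd[OF that] by simp
  have nnG: "(\<integral>\<^sup>+r. ennreal (m r) * indicator {s<..t} r \<partial>lborel) = ennreal (G t - G s)" if "s \<le> t" for s t
  proof -
    have "(\<integral>\<^sup>+r. ennreal (m r) * indicator {s<..t} r \<partial>lborel)
          = (\<integral>\<^sup>+r. ennreal (indicator {s..t} r * m r) \<partial>lborel)"
      using AE_lborel_singleton[of s]
      by (intro nn_integral_cong_AE) (auto simp: indicator_def elim!: eventually_mono)
    also have "\<dots> = ennreal (LINT r|lborel. indicator {s..t} r * m r)"
      using set_integrable_lborel[OF m, of "{s..t}"] m0
      by (intro nn_integral_eq_integral) (auto simp: set_integrable_def)
    finally show ?thesis using Gd[OF that] by (simp add: set_lebesgue_integral_def)
  qed
  have contG: "isCont G x" for x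
    unfolding G_def by (rule isCont_LINT_atMost[OF m])
  have "dist (\<phi> y) (\<phi> x) \<le> \<bar>G y - G x\<bar>" for x y
    unfolding dist_real_def using bd[of x y] bd[of y x] by linarith
  then have cont\<phi>: "isCont \<phi> x" for x
    using contG by (rule isCont_if_dist_le)
  define F where "F = (\<lambda>x. G x + \<phi> x)"
  define H where "H = (\<lambda>x. G x - \<phi> x)"
  have F_mono: "F s \<le> F t" and H_mono: "H s \<le> H t" if "s \<le> t" for s t
    using bd[OF that] by (auto simp: F_def H_def)
  \<comment> \<open>\<open>interval_measure\<close> gives a half-open interval the increment of its
    function provided that the function is increasing and right-continuous.\<close>
  have "continuous (at_right x) F" "continuous (at_right x) H" for x
    unfolding F_def H_def
    by (auto intro!: continuous_intros continuous_at_imp_continuous_at_within[OF contG]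
          continuous_at_imp_continuous_at_within[OF cont\<phi>])
  note Ioc = emeasure_interval_measure_Ioc_eq[of F, OF F_mono this(1)]
    emeasure_interval_measure_Ioc_eq[of H, OF H_mono this(2)]
  let ?S = "measure_of (space (interval_measure F)) (sets (interval_measure F))
    (\<lambda>A. emeasure (interval_measure F) A + emeasure (interval_measure H) A)"
  have S: "emeasure ?S A = emeasure (interval_measure F) A + emeasure (interval_measure H) A"
    if "A \<in> sets borel" for A
    using that by (intro emeasure_sum_measure) auto
  \<comment> \<open>\<open>interval_measure F\<close> is absolutely continuous because adding \<open>interval_measure H\<close> turns it into a
    measure with an explicit density: \<open>F + H = 2 G\<close>.\<close>
  have Seq: "?S = density lborel (\<lambda>r. 2 * ennreal (m r))"
  proof (rule measure_eqI_generator_eq[where E="range (\<lambda>(a, b). {a<..b::real})" and \<Omega>=UNIV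
        and A="\<lambda>i. {-real i<..real i}"])
    show "Int_stable (range (\<lambda>(a, b). {a<..b::real}))"
      by (auto simp: Int_stable_def)
    have sb: "sets borel = sigma_sets UNIV (range (\<lambda>(a, b). {a<..b::real}))"
      by (subst borel_sigma_sets_Ioc) auto
    show "sets ?S = sigma_sets UNIV (range (\<lambda>(a, b). {a<..b::real}))"
      by (simp add: sb[symmetric] sets.sigma_sets_eq[of borel, simplified])
    show "sets (density lborel (\<lambda>r. 2 * ennreal (m r))) = sigma_sets UNIV (range (\<lambda>(a, b). {a<..b::real}))"
      using sb by simp
    show "emeasure ?S {-real i<..real i} \<noteq> \<infinity>" for i
      by (subst S) (auto simp: Ioc)
    show "(\<Union>i. {-real i<..real i}) = UNIV"
    proof -
      have "\<exists>i. - real i < x \<and> x \<le> real i" for x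
        using reals_Archimedean2[of "\<bar>x\<bar>"] by (metis abs_less_iff less_imp_le minus_less_iff)
      then show ?thesis by auto
    qed
    fix X :: "real set" assume "X \<in> range (\<lambda>(a, b). {a<..b})"
    then obtain a b where X: "X = {a<..b}" by auto
    show "emeasure ?S X = emeasure (density lborel (\<lambda>r. 2 * ennreal (m r))) X"
    proof (cases "a \<le> b")
      case True
      have "(\<integral>\<^sup>+r. 2 * ennreal (m r) * indicator {a<..b} r \<partial>lborel) = 2 * ennreal (G b - G a)"
        using m by (subst nnG[OF True, symmetric], subst nn_integral_cmult[symmetric])
          (auto simp: mult.assoc)
      also have "\<dots> = ennreal (2 * (G b - G a))"
        using bd[OF True] by (subst ennreal_mult) auto
      also have "\<dots> = ennreal (F b - F a) + ennreal (H b - H a)"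
        using F_mono[OF True] H_mono[OF True] by (subst ennreal_plus[symmetric]) (auto simp: F_def H_def)
      finally show ?thesis
        unfolding X using m True by (subst S) (auto simp: Ioc emeasure_density)
    qed (simp add: X)
  qed auto
  have "absolutely_continuous lborel (interval_measure F)"
    unfolding absolutely_continuous_def
  proof
    fix A assume A: "A \<in> null_sets (lborel :: real measure)"
    have "emeasure (density lborel (\<lambda>r. 2 * ennreal (m r))) A = 0"
      using A m absolutely_continuousI_density[of "\<lambda>r. 2 * ennreal (m r)" lborel]
      by (auto simp: absolutely_continuous_def)
    then show "A \<in> null_sets (interval_measure F)"
      using A S[of A] unfolding Seq[symmetric] by (auto simp: null_sets_def)
  qed
  then obtain p where p[measurable]: "p \<in> borel_measurable lborel" and dp: "density lborel p = interval_measure F"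
    using sigma_finite_measure.Radon_Nikodym[OF sigma_finite_lborel, of "interval_measure F"] by auto
  \<comment> \<open>The total mass of \<open>interval_measure F\<close> is at most twice the
    integral of \<open>m\<close>. Hence \<open>p\<close> is finite almost everywhere and can be
    replaced by an integrable real function.\<close>
  have "(\<integral>\<^sup>+r. p r \<partial>lborel) = emeasure (interval_measure F) UNIV"
    by (subst dp[symmetric]) (simp add: emeasure_density)
  also have "\<dots> \<le> emeasure ?S UNIV"
    by (subst S) auto
  also have "\<dots> = 2 * (\<integral>\<^sup>+r. ennreal (m r) \<partial>lborel)"
    unfolding Seq using m by (simp add: emeasure_density nn_integral_cmult)
  also have "\<dots> < \<infinity>"
    using m m0 by (simp add: nn_integral_eq_integral ennreal_mult_less_top)
  finally have pfin: "(\<integral>\<^sup>+r. p r \<partial>lborel) < \<infinity>" .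
  then have pAE: "AE r in lborel. p r \<noteq> \<infinity>"
    by (intro nn_integral_PInf_AE) auto
  have enn: "(\<integral>\<^sup>+r. ennreal (enn2real (p r)) * indicator A r \<partial>lborel) = (\<integral>\<^sup>+r. p r * indicator A r \<partial>lborel)" for A
    using pAE by (intro nn_integral_cong_AE) (auto simp: less_top elim!: eventually_mono)
  define q where "q = (\<lambda>r. enn2real (p r))"
  have q: "integrable lborel q"
    unfolding q_def using pfin enn[of UNIV] by (intro integrableI_nonneg) auto
  have qF: "(LINT r:{s..t}|lborel. q r) = F t - F s" if "s \<le> t" for s t
  proof -
    have "ennreal (LINT r:{s..t}|lborel. q r) = (\<integral>\<^sup>+r. ennreal (indicator {s..t} r * q r) \<partial>lborel)"
      using set_integrable_lborel[OF q, of "{s..t}"]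
      by (subst nn_integral_eq_integral) (auto simp: set_integrable_def q_def set_lebesgue_integral_def)
    also have "\<dots> = (\<integral>\<^sup>+r. ennreal (q r) * indicator {s<..t} r \<partial>lborel)"
      using AE_lborel_singleton[of s]
      by (intro nn_integral_cong_AE) (auto simp: indicator_def elim!: eventually_mono)
    also have "\<dots> = emeasure (density lborel p) {s<..t}"
      unfolding q_def enn by (simp add: emeasure_density)
    also have "\<dots> = ennreal (F t - F s)"
      using that by (simp add: dp Ioc)
    finally show ?thesis
      using F_mono[OF that]
      by (subst (asm) ennreal_inj) (auto simp: set_lebesgue_integral_def q_def)
  qed
  show ?thesis
  proof (intro exI[of _ "\<lambda>r. q r - m r"] conjI allI impI)
    show "integrable lborel (\<lambda>r. q r - m r)" using q m by simp
    fix s t :: real assume "s \<le> t"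
    then show "\<phi> t - \<phi> s = (LINT r:{s..t}|lborel. q r - m r)"
      using set_integral_diff(2)[OF set_integrable_lborel[OF q, of "{s..t}"] set_integrable_lborel[OF m, of "{s..t}"]]
        qF[OF \<open>s \<le> t\<close>] Gd[OF \<open>s \<le> t\<close>] by (simp add: F_def)
  qed
qed

lemma has_integral_derivative_AE:
  fixes \<phi> k :: "real \<Rightarrow> real"
  assumes k: "integrable lborel k"
    and \<phi>: "\<And>s t. s \<le> t \<Longrightarrow> \<phi> t - \<phi> s = (LINT r:{s..t}|lborel. k r)"
  shows "AE t in lborel. (\<phi> has_real_derivative k t) (at t)"
proof -
  define P where "P = (\<lambda>y. LINT r:{..y}|lborel. k r)"
  have "\<phi> t = P t + (\<phi> 0 - P 0)" for t
    using LINT_atMost_diff[OF k, of 0 t] LINT_atMost_diff[OF k, of t 0] \<phi>[of 0 t] \<phi>[of t 0]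
    by (cases "0 \<le> t") (auto simp: P_def)
  then have eq: "\<phi> = (\<lambda>t. P t + (\<phi> 0 - P 0))" by blast
  have "AE t in lborel. (P has_real_derivative k t) (at t)"
    unfolding P_def by (rule lebesgue_differentiation_real[OF k])
  then show ?thesis
    by eventually_elim (subst eq, auto intro!: derivative_eq_intros)
qed

lemma has_real_derivative_abs_quotient:
  assumes "(f has_real_derivative D) (at x)"
  shows "((\<lambda>h. \<bar>f (x + h) - f x\<bar> / \<bar>h\<bar>) \<longlongrightarrow> \<bar>D\<bar>) (at 0)"
  using tendsto_rabs[OF assms[unfolded DERIV_def]] by simp

subsection \<open>Metric derivative of absolutely continuous curves\<close>

text \<open>Each \<open>\<phi> q\<close> is a 1-Lipschitz function of the position, so the
  difference quotients of \<open>w\<close> are eventually above any number below some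
  \<open>\<bar>k q t\<bar>\<close>. The bound by the integral of \<open>M\<close>, differentiated
  through its primitive \<open>P\<close>, controls them from above; as \<open>M\<close> is the
  supremum of the \<open>\<bar>k q\<bar>\<close>, the two bounds meet.\<close>

theorem metric_derivative_exists:
  fixes w :: "real \<Rightarrow> 'a::metric_space" and m :: "real \<Rightarrow> real"
  assumes m: "integrable lborel m" and m0: "\<And>r. 0 \<le> m r"
    and w: "\<And>s t. s \<le> t \<Longrightarrow> dist (w t) (w s) \<le> (LINT r:{s..t}|lborel. m r)"
  shows "\<exists>M. integrable lborel M \<and> (\<forall>r. 0 \<le> M r) \<and>
           (\<forall>s t. s \<le> t \<longrightarrow> dist (w t) (w s) \<le> (LINT r:{s..t}|lborel. M r)) \<and>
           (AE t in lborel. ((\<lambda>h. dist (w (t + h)) (w t) / \<bar>h\<bar>) \<longlongrightarrow> M t) (at 0))"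
proof -
  \<comment> \<open>Countably many base points allow the exceptional null sets to be united, and by
    continuity of \<open>w\<close> the values at rational times are dense in its image.\<close>
  define \<phi> where "\<phi> = (\<lambda>(q::rat) t. dist (w t) (w (of_rat q)))"
  have \<phi>w: "\<bar>\<phi> q t - \<phi> q s\<bar> \<le> dist (w t) (w s)" for q s t
    unfolding \<phi>_def using dist_triangle3[of "w t" "w (of_rat q)" "w s"]
      dist_triangle[of "w s" "w (of_rat q)" "w t"] dist_triangle[of "w t" "w (of_rat q)" "w s"]
    by (auto simp: dist_commute abs_le_iff)
  have "\<exists>k. integrable lborel k \<and> (\<forall>s t. s \<le> t \<longrightarrow> \<phi> q t - \<phi> q s = (LINT r:{s..t}|lborel. k r))" for q
    using \<phi>w w by (intro absolutely_continuous_real_integral[OF m m0]) (blast intro: order_trans)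
  then obtain k where k: "\<And>q. integrable lborel (k q)"
    and k\<phi>: "\<And>q s t. s \<le> t \<Longrightarrow> \<phi> q t - \<phi> q s = (LINT r:{s..t}|lborel. k q r)"
    by metis
  have [measurable]: "k q \<in> borel_measurable borel" for q
    using k[of q] by auto
  have d\<phi>: "AE t in lborel. \<forall>q. (\<phi> q has_real_derivative k q t) (at t)"
    unfolding AE_all_countable using has_integral_derivative_AE[OF k k\<phi>] by blast
  define G where "G = (\<lambda>x. LINT r:{..x}|lborel. m r)"
  have dG: "AE t in lborel. (G has_real_derivative m t) (at t)"
    unfolding G_def by (rule lebesgue_differentiation_real[OF m])
  have wG: "dist (w t) (w s) \<le> \<bar>G t - G s\<bar>" for s t
    using w[of s t] w[of t s] LINT_atMost_diff[OF m, of s t] LINT_atMost_diff[OF m, of t s]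
    by (cases "s \<le> t") (auto simp: G_def dist_commute)
  \<comment> \<open>Comparison with the difference quotients of the primitive of \<open>m\<close>
    bounds all \<open>k q\<close> by \<open>m\<close> at once, which makes their supremum finite
    almost everywhere and integrable.\<close>
  have km: "AE t in lborel. \<forall>q. \<bar>k q t\<bar> \<le> m t"
    using d\<phi> dG
  proof eventually_elim
    case (elim t)
    show ?case
    proof
      fix q
      have "\<bar>k q t\<bar> \<le> \<bar>m t\<bar>"
      proof (rule tendsto_le)
        show "((\<lambda>h. \<bar>G (t + h) - G t\<bar> / \<bar>h\<bar>) \<longlongrightarrow> \<bar>m t\<bar>) (at 0)"
          using elim by (intro has_real_derivative_abs_quotient) auto
        show "((\<lambda>h. \<bar>\<phi> q (t + h) - \<phi> q t\<bar> / \<bar>h\<bar>) \<longlongrightarrow> \<bar>k q t\<bar>) (at 0)"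
          using elim by (intro has_real_derivative_abs_quotient) auto
        show "\<forall>\<^sub>F h in at 0. \<bar>\<phi> q (t + h) - \<phi> q t\<bar> / \<bar>h\<bar> \<le> \<bar>G (t + h) - G t\<bar> / \<bar>h\<bar>"
          using order_trans[OF \<phi>w wG] by (intro always_eventually allI divide_right_mono) auto
      qed simp
      then show "\<bar>k q t\<bar> \<le> m t" using m0[of t] by simp
    qed
  qed
  \<comment> \<open>The supremum is formed in \<open>ennreal\<close>, where it exists and is
    measurable without exception. Where it is infinite, which happens only on a null set,
    \<open>enn2real\<close> returns 0.\<close>
  define M where "M = (\<lambda>r. enn2real (SUP q. ennreal \<bar>k q r\<bar>))"
  have [measurable]: "M \<in> borel_measurable borel"
    unfolding M_def by measurable
  have M0: "0 \<le> M r" for r by (simp add: M_def)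
  have ennM: "AE r in lborel. ennreal (M r) = (SUP q. ennreal \<bar>k q r\<bar>) \<and> M r \<le> m r"
    using km
  proof eventually_elim
    case (elim r)
    have le: "(SUP q. ennreal \<bar>k q r\<bar>) \<le> ennreal (m r)"
      using elim by (intro SUP_least ennreal_leI) auto
    then show ?case
      using m0[of r] le le_less_trans[OF le ennreal_less_top] unfolding M_def
      by (auto simp: enn2real_leI)
  qed
  have M: "integrable lborel M"
    using ennM M0 m0 by (intro Bochner_Integration.integrable_bound[OF m]) (auto elim!: eventually_mono)
  have kM: "AE r in lborel. \<forall>q. \<bar>k q r\<bar> \<le> M r"
    using ennM
  proof eventually_elim
    case (elim r)
    show ?case
    proof
      fix q
      have "ennreal \<bar>k q r\<bar> \<le> ennreal (M r)"
        unfolding elim[THEN conjunct1] by (rule SUP_upper) simp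
      then show "\<bar>k q r\<bar> \<le> M r" using M0 by (simp add: ennreal_le_iff)
    qed
  qed
  have contw: "isCont w x" for x
    using wG isCont_LINT_atMost[OF m, folded G_def] by (rule isCont_if_dist_le)
  have wM: "dist (w t) (w s) \<le> (LINT r:{s..t}|lborel. M r)" if "s \<le> t" for s t
  proof (rule field_le_epsilon)
    fix e :: real assume "e > 0"
    then obtain d where d: "d > 0" "\<And>y. dist y s < d \<Longrightarrow> dist (w y) (w s) < e / 2"
      using contw[of s] unfolding continuous_at_eps_delta by (metis half_gt_zero)
    obtain q :: rat where "s < of_rat q" "of_rat q < s + d"
      using of_rat_dense[of s "s + d"] d(1) by auto
    then have q: "dist (w (of_rat q)) (w s) < e / 2"
      by (intro d(2)) (auto simp: dist_real_def)
    \<comment> \<open>Replacing \<open>w s\<close> by \<open>w (of_rat q)\<close> costs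
      \<open>dist (w (of_rat q)) (w s)\<close> twice: once in the triangle inequality and once as
      the subtracted term \<open>\<phi> q s\<close>.\<close>
    have "dist (w t) (w s) \<le> \<phi> q t - \<phi> q s + e"
      using q dist_triangle[of "w t" "w s" "w (of_rat q)"] by (auto simp: \<phi>_def dist_commute)
    also have "\<phi> q t - \<phi> q s \<le> (LINT r:{s..t}|lborel. M r)"
      unfolding k\<phi>[OF that] set_lebesgue_integral_def
      using set_integrable_lborel[OF k, of "{s..t}"] set_integrable_lborel[OF M, of "{s..t}"] kM
      by (intro integral_mono_AE) (auto simp: set_integrable_def indicator_def abs_le_iff elim!: eventually_mono)
    finally show "dist (w t) (w s) \<le> (LINT r:{s..t}|lborel. M r) + e" by simp
  qed
  define P where "P = (\<lambda>x. LINT r:{..x}|lborel. M r)"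
  have dP: "AE t in lborel. (P has_real_derivative M t) (at t)"
    unfolding P_def by (rule lebesgue_differentiation_real[OF M])
  have wP: "dist (w t) (w s) \<le> \<bar>P t - P s\<bar>" for s t
    using wM[of s t] wM[of t s] LINT_atMost_diff[OF M, of s t] LINT_atMost_diff[OF M, of t s]
    by (cases "s \<le> t") (auto simp: P_def dist_commute)
  have "AE t in lborel. ((\<lambda>h. dist (w (t + h)) (w t) / \<bar>h\<bar>) \<longlongrightarrow> M t) (at 0)"
    using dP d\<phi> ennM
  proof eventually_elim
    case (elim t)
    show ?case
    proof (rule order_tendstoI)
      fix a assume "a < M t"
      have "\<exists>q. a < \<bar>k q t\<bar>"
      proof (rule ccontr)
        assume "\<not> ?thesis"
        then have "\<And>q. \<bar>k q t\<bar> \<le> a" by (simp add: not_less)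
        then have "0 \<le> a" "(SUP q. ennreal \<bar>k q t\<bar>) \<le> ennreal a"
          by (auto intro!: SUP_least ennreal_leI intro: order_trans[OF abs_ge_zero])
        then show False
          using elim(3) \<open>a < M t\<close> by (metis ennreal_le_iff not_less)
      qed
      then obtain q where "a < \<bar>k q t\<bar>" ..
      moreover have "((\<lambda>h. \<bar>\<phi> q (t + h) - \<phi> q t\<bar> / \<bar>h\<bar>) \<longlongrightarrow> \<bar>k q t\<bar>) (at 0)"
        using elim by (intro has_real_derivative_abs_quotient) auto
      ultimately have "\<forall>\<^sub>F h in at 0. a < \<bar>\<phi> q (t + h) - \<phi> q t\<bar> / \<bar>h\<bar>"
        by (rule order_tendstoD(1)[rotated])
      then show "\<forall>\<^sub>F h in at 0. a < dist (w (t + h)) (w t) / \<bar>h\<bar>"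
      proof eventually_elim
        case (elim h)
        also have "\<bar>\<phi> q (t + h) - \<phi> q t\<bar> / \<bar>h\<bar> \<le> dist (w (t + h)) (w t) / \<bar>h\<bar>"
          by (intro divide_right_mono \<phi>w) simp
        finally show ?case .
      qed
    next
      fix a assume "M t < a"
      moreover have "((\<lambda>h. \<bar>P (t + h) - P t\<bar> / \<bar>h\<bar>) \<longlongrightarrow> \<bar>M t\<bar>) (at 0)"
        using elim by (intro has_real_derivative_abs_quotient) auto
      ultimately have "\<forall>\<^sub>F h in at 0. \<bar>P (t + h) - P t\<bar> / \<bar>h\<bar> < a"
        using M0[of t] by (intro order_tendstoD(2)[where y="\<bar>M t\<bar>"]) auto
      then show "\<forall>\<^sub>F h in at 0. dist (w (t + h)) (w t) / \<bar>h\<bar> < a"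
      proof eventually_elim
        case (elim h)
        have "dist (w (t + h)) (w t) / \<bar>h\<bar> \<le> \<bar>P (t + h) - P t\<bar> / \<bar>h\<bar>"
          by (intro divide_right_mono wP) simp
        also note elim
        finally show ?case .
      qed
    qed
  qed
  then show ?thesis using M M0 wM by blast
qed

theorem locally_ac_curve_metric_deriv:
  fixes v :: "real \<Rightarrow> 'a::metric_space"
  assumes v: "locally_ac_curve v" and ab: "0 < a" "a \<le> b"
  obtains M where "integrable lborel M" "\<And>r. 0 \<le> M r"
    "\<And>s t. a \<le> s \<Longrightarrow> s \<le> t \<Longrightarrow> t \<le> b \<Longrightarrow> dist (v t) (v s) \<le> (LINT r:{s..t}|lborel. M r)"
    "AE t in lborel. t \<in> {a..b} \<longrightarrow> metric_deriv v t = M t"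
proof -
  obtain m where m: "\<And>r. r > 0 \<Longrightarrow> 0 \<le> m r" "set_integrable lborel {a..b} m"
    "\<And>s t. 0 < s \<Longrightarrow> s \<le> t \<Longrightarrow> dist (v t) (v s) \<le> (LINT r:{s..t}|lborel. m r)"
    using v ab unfolding locally_ac_curve_def by metis
  define w where "w = (\<lambda>t. v (max a (min b t)))"
  define n where "n = (\<lambda>r. indicator {a..b} r * m r)"
  have n1: "integrable lborel n"
    using m(2) by (simp add: n_def set_integrable_def)
  have n0: "0 \<le> n r" for r
    using m(1)[of r] ab by (auto simp: n_def indicator_def)
  have nw: "dist (w t) (w s) \<le> (LINT r:{s..t}|lborel. n r)" if "s \<le> t" for s t
  proof (cases "t < a \<or> b < s")
    case True
    then have "w t = w s" using that ab by (auto simp: w_def)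
    moreover have "0 \<le> (LINT r:{s..t}|lborel. n r)"
      unfolding set_lebesgue_integral_def using n0 by (intro integral_nonneg_AE) auto
    ultimately show ?thesis by simp
  next
    case False
    then have "dist (w t) (w s) \<le> (LINT r:{max a s..min b t}|lborel. m r)"
      using m(3)[of "max a s" "min b t"] that ab by (auto simp: w_def min_def max_def)
    also have "\<dots> = (LINT r:{s..t}|lborel. n r)"
      unfolding set_lebesgue_integral_def n_def
      by (intro Bochner_Integration.integral_cong) (auto simp: indicator_def)
    finally show ?thesis .
  qed
  obtain M where M: "integrable lborel M" "\<And>r. 0 \<le> M r"
    "\<And>s t. s \<le> t \<Longrightarrow> dist (w t) (w s) \<le> (LINT r:{s..t}|lborel. M r)"
    and lim: "AE t in lborel. ((\<lambda>h. dist (w (t + h)) (w t) / \<bar>h\<bar>) \<longlongrightarrow> M t) (at 0)"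
    using metric_derivative_exists[OF n1 n0 nw] by blast
  have "AE t in lborel. t \<in> {a..b} \<longrightarrow> metric_deriv v t = M t"
    using lim AE_lborel_singleton[of a] AE_lborel_singleton[of b]
  proof eventually_elim
    case (elim t)
    show ?case
    proof
      assume "t \<in> {a..b}"
      with elim have t: "a < t" "t < b" by auto
      have "\<forall>\<^sub>F h in at 0. dist (w (t + h)) (w t) / \<bar>h\<bar> = dist (v (t + h)) (v t) / \<bar>h\<bar>"
        unfolding eventually_at using t
        by (intro exI[of _ "min (t - a) (b - t)"]) (auto simp: w_def dist_real_def min_def max_def)
      from Lim_transform_eventually[OF elim(1) this]
      show "metric_deriv v t = M t"
        unfolding metric_deriv_def by (intro tendsto_Lim) auto
    qed
  qed
  moreover have "dist (v t) (v s) \<le> (LINT r:{s..t}|lborel. M r)" if "a \<le> s" "s \<le> t" "t \<le> b" for s t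
    using M(3)[OF that(2)] that by (simp add: w_def min_absorb2 max_absorb2)
  ultimately show ?thesis using M that by blast
qed

text \<open>Used twice, for the curve itself and for \<open>\<Phi>\<close> along it: the increments
  from \<open>a\<close> are squeezed by those of a continuous primitive.\<close>

lemma tendsto_at_right_if_dist_le_LINT:
  fixes f :: "real \<Rightarrow> 'a::metric_space" and k :: "real \<Rightarrow> real"
  assumes k: "integrable lborel k" and "a < b"
    and f: "\<And>t. a \<le> t \<Longrightarrow> t \<le> b \<Longrightarrow> dist (f t) (f a) \<le> (LINT r:{a..t}|lborel. k r)"
  shows "(f \<longlongrightarrow> f a) (at_right a)"
proof -
  define P where "P = (\<lambda>x. LINT r:{..x}|lborel. k r)"
  have "isCont P a"
    unfolding P_def by (rule isCont_LINT_atMost[OF k])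
  then have "((\<lambda>t. P t - P a) \<longlongrightarrow> 0) (at_right a)"
    by (auto intro!: tendsto_eq_intros simp: isCont_def intro: tendsto_mono[OF at_le])
  moreover have "\<forall>\<^sub>F t in at_right a. dist (f t) (f a) \<le> P t - P a"
    using eventually_at_right_real[OF \<open>a < b\<close>]
    by eventually_elim (use f LINT_atMost_diff[OF k] in \<open>auto simp: P_def\<close>)
  ultimately show ?thesis
    unfolding tendsto_dist_iff[of f]
    by (intro tendsto_sandwich[of "\<lambda>_. 0" "\<lambda>t. dist (f t) (f a)"]) auto
qed

lemma locally_ac_curve_tendsto_at_right:
  assumes "locally_ac_curve v" and "0 < a"
  shows "(v \<longlongrightarrow> v a) (at_right a)"
proof -
  obtain M where "integrable lborel M"
    "\<And>s t. a \<le> s \<Longrightarrow> s \<le> t \<Longrightarrow> t \<le> a + 1 \<Longrightarrow> dist (v t) (v s) \<le> (LINT r:{s..t}|lborel. M r)"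
    using locally_ac_curve_metric_deriv[OF assms(1,2), of "a + 1"] by (metis less_add_one less_imp_le)
  then show ?thesis
    by (intro tendsto_at_right_if_dist_le_LINT[of M a "a + 1"]) auto
qed

subsection \<open>Gradient flows\<close>

lemma ennreal_power2_top [simp]: "(top::ennreal)\<^sup>2 = top"
  by (simp add: power2_eq_square)

lemma ennreal_young: "2 * (a * x) \<le> a\<^sup>2 + (x::ennreal)\<^sup>2"
proof (cases a; cases x)
  fix p q :: real assume "0 \<le> p" "0 \<le> q" "a = ennreal p" "x = ennreal q"
  then have "2 * (a * x) = ennreal (2 * (p * q))" "a\<^sup>2 + x\<^sup>2 = ennreal (p\<^sup>2 + q\<^sup>2)"
    by (simp_all add: ennreal_mult ennreal_power)
  then show ?thesis
    using sum_squares_bound[of p q] ennreal_leI[of "2 * (p * q)" "p\<^sup>2 + q\<^sup>2"] by (simp add: mult.assoc)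
qed auto

text \<open>The strictness comes entirely from \<open>c < x\<close>, so it persists when
  \<open>p = 0\<close>, that is, where the curve has zero speed.\<close>

lemma ennreal_young_strict:
  assumes "0 \<le> p" "0 \<le> c" "ennreal c < x"
  shows "ennreal (2 * c * p) < (ennreal p)\<^sup>2 + x\<^sup>2"
proof (cases x)
  case (real q)
  then have "c < q" using assms by (simp add: ennreal_less_iff)
  have "2 * c * p \<le> p\<^sup>2 + c\<^sup>2" using sum_squares_bound[of p c] by (simp add: mult_ac)
  also have "\<dots> < p\<^sup>2 + q\<^sup>2" using \<open>c < q\<close> assms by (simp add: power_strict_mono)
  finally have "2 * c * p < p\<^sup>2 + q\<^sup>2" .
  then have "ennreal (2 * c * p) < ennreal (p\<^sup>2 + q\<^sup>2)"
    using assms \<open>2 * c * p < p\<^sup>2 + q\<^sup>2\<close>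
    by (intro ennreal_lessI) (auto intro: le_less_trans[of _ "2 * c * p"])
  then show ?thesis using real assms by (simp add: ennreal_power)
qed simp

section \<open>Energy dissipation along a gradient flow\<close>

lemma gradient_flow_finite:
  assumes "proper_functional \<Phi>" "gradient_flow \<Phi> g v" "0 < t"
  shows "\<bar>\<Phi> (v t)\<bar> \<noteq> \<infinity>"
proof -
  have "\<Phi> (v t) < \<infinity>" "\<Phi> (v t) \<noteq> - \<infinity>"
    using assms by (simp_all add: gradient_flow_def proper_functional_def eff_dom_def)
  then show ?thesis by auto
qed

text \<open>A finite left-hand side excludes infinite dissipation, so both integrals are real
  numbers and the inequality can be rearranged.\<close>

lemma ennreal_energy_inequality:
  fixes A B :: ennreal
  assumes "ereal x - ereal y \<le> - (ereal (1/2) * enn2ereal A) - ereal (1/2) * enn2ereal B"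
  shows "x \<le> y \<and> A + B \<le> ennreal (2 * (y - x))"
proof (cases A)
  case (real a)
  show ?thesis
  proof (cases B)
    case (real b)
    have "x - y \<le> - (1/2 * a) - 1/2 * b"
      using assms \<open>A = ennreal a\<close> \<open>0 \<le> a\<close> real by (simp add: enn2ereal_ennreal)
    then have "a + b \<le> 2 * (y - x)" by simp
    moreover have "A + B = ennreal (a + b)"
      using \<open>A = ennreal a\<close> \<open>0 \<le> a\<close> real by simp
    ultimately show ?thesis
      using \<open>0 \<le> a\<close> \<open>0 \<le> b\<close> ennreal_leI[of "a + b" "2 * (y - x)"] by simp
  next
    case top
    then show ?thesis using assms real by (simp add: enn2ereal_ennreal)
  qed
next
  case top
  then show ?thesis using assms by (cases B) (simp_all add: enn2ereal_ennreal)
qed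

lemma gradient_flow_energy:
  assumes \<Phi>: "proper_functional \<Phi>" and v: "gradient_flow \<Phi> g v" and st: "0 < s" "s \<le> t"
  shows "real_of_ereal (\<Phi> (v t)) \<le> real_of_ereal (\<Phi> (v s))"
    and "(\<integral>\<^sup>+ r\<in>{s..t}. (ennreal (metric_deriv v r))\<^sup>2 \<partial>lborel) + (\<integral>\<^sup>+ r\<in>{s..t}. (g (v r))\<^sup>2 \<partial>lborel)
           \<le> ennreal (2 * (real_of_ereal (\<Phi> (v s)) - real_of_ereal (\<Phi> (v t))))"
proof -
  have "0 < t" using st by simp
  obtain x y where xy: "\<Phi> (v t) = ereal x" "\<Phi> (v s) = ereal y"
    using gradient_flow_finite[OF \<Phi> v \<open>0 < t\<close>] gradient_flow_finite[OF \<Phi> v \<open>0 < s\<close>]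
    by (metis abs_neq_infinity_cases)
  let ?A = "\<integral>\<^sup>+ r\<in>{s..t}. (ennreal (metric_deriv v r))\<^sup>2 \<partial>lborel"
  let ?B = "\<integral>\<^sup>+ r\<in>{s..t}. (g (v r))\<^sup>2 \<partial>lborel"
  have "\<Phi> (v t) - \<Phi> (v s) \<le> - (ereal (1/2) * enn2ereal ?A) - ereal (1/2) * enn2ereal ?B"
    using v[unfolded gradient_flow_def, THEN conjunct2, THEN conjunct2, rule_format, OF st(1) \<open>0 < t\<close>] st
    by (simp add: oriented_nn_integral_def)
  then have "x \<le> y \<and> ?A + ?B \<le> ennreal (2 * (y - x))"
    unfolding xy by (rule ennreal_energy_inequality)
  then show "real_of_ereal (\<Phi> (v t)) \<le> real_of_ereal (\<Phi> (v s))"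
    "?A + ?B \<le> ennreal (2 * (real_of_ereal (\<Phi> (v s)) - real_of_ereal (\<Phi> (v t))))"
    by (auto simp: xy)
qed

text \<open>An upper gradient is measurable along curves only on the positive half-line. Extension
  by zero yields a Borel function on all reals, fit for integration against
  \<open>lborel\<close>.\<close>

lemma upper_gradient_measurable:
  assumes "upper_gradient \<Phi> g" "gradient_flow \<Phi> g v"
  shows "(\<lambda>r. g (v r) * indicator {0<..} r) \<in> borel_measurable borel"
proof -
  have "locally_ac_curve v" "\<forall>t>0. v t \<in> eff_dom \<Phi>"
    using assms(2) by (simp_all add: gradient_flow_def)
  then have "(\<lambda>r. g (v r)) \<in> borel_measurable (restrict_space borel {0<..})"
    using assms(1)[unfolded upper_gradient_def, rule_format, of v] by blast
  then show ?thesis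
    by (subst (asm) borel_measurable_restrict_space_iff_ennreal) auto
qed

text \<open>While \<open>g > c\<close>, the strict Young inequality makes the dissipation exceed
  \<open>2 * c\<close> times the speed, and integration gives the first claim. Keeping only the
  \<open>g\<close> term gives the second, which bounds how long the slope can stay above
  \<open>c > 0\<close> when \<open>\<Phi>\<close> is bounded below. The condition on
  \<open>g\<close> concerns the open interval because nothing is known about \<open>g\<close> at the
  first time when the slope may become small.\<close>

lemma gradient_flow_slope:
  assumes \<Phi>: "proper_functional \<Phi>" and g: "upper_gradient \<Phi> g" and v: "gradient_flow \<Phi> g v"
    and st: "0 < s" "s < t" and c: "0 \<le> c" "\<And>r. s < r \<Longrightarrow> r < t \<Longrightarrow> ennreal c < g (v r)"
  shows "c * dist (v t) (v s) < real_of_ereal (\<Phi> (v s)) - real_of_ereal (\<Phi> (v t))"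
    and "c\<^sup>2 * (t - s) \<le> 2 * (real_of_ereal (\<Phi> (v s)) - real_of_ereal (\<Phi> (v t)))"
proof -
  define D where "D = real_of_ereal (\<Phi> (v s)) - real_of_ereal (\<Phi> (v t))"
  have "D \<ge> 0" unfolding D_def using gradient_flow_energy(1)[OF \<Phi> v] st by simp
  have ac: "locally_ac_curve v" using v by (simp add: gradient_flow_def)
  obtain M where M: "integrable lborel M" "\<And>r. 0 \<le> M r"
    "dist (v t) (v s) \<le> (LINT r:{s..t}|lborel. M r)"
    "AE r in lborel. r \<in> {s..t} \<longrightarrow> metric_deriv v r = M r"
    using locally_ac_curve_metric_deriv[OF ac st(1) less_imp_le[OF st(2)]] st by (metis order_refl less_imp_le)
  define k where "k = (\<lambda>r. g (v r) * indicator {0<..} r)"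
  have [measurable]: "k \<in> borel_measurable borel"
    unfolding k_def by (rule upper_gradient_measurable[OF g v])
  have [measurable]: "M \<in> borel_measurable borel" using M(1) by simp
  let ?A = "\<integral>\<^sup>+ r\<in>{s..t}. (ennreal (metric_deriv v r))\<^sup>2 \<partial>lborel"
  let ?B = "\<integral>\<^sup>+ r\<in>{s..t}. (g (v r))\<^sup>2 \<partial>lborel"
  have AB: "?A + ?B \<le> ennreal (2 * D)"
    unfolding D_def using gradient_flow_energy(2)[OF \<Phi> v st(1) less_imp_le[OF st(2)]] .
  \<comment> \<open>Merging the two integrals into one requires measurable integrands, so
    \<open>metric_deriv v\<close> and \<open>g\<close> along \<open>v\<close> are replaced by
    \<open>M\<close> and \<open>k\<close>.\<close>
  have A: "?A = (\<integral>\<^sup>+ r\<in>{s..t}. (ennreal (M r))\<^sup>2 \<partial>lborel)"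
    using M(4) by (intro nn_integral_cong_AE) (auto simp: indicator_def elim!: eventually_mono)
  have B: "?B = (\<integral>\<^sup>+ r\<in>{s..t}. (k r)\<^sup>2 \<partial>lborel)"
    using st by (intro nn_integral_cong) (auto simp: indicator_def k_def)
  have "?A + ?B = (\<integral>\<^sup>+ r\<in>{s..t}. (ennreal (M r))\<^sup>2 + (k r)\<^sup>2 \<partial>lborel)"
    unfolding A B by (subst nn_integral_add[symmetric]) (auto simp: distrib_right)
  have I: "(\<integral>\<^sup>+ r\<in>{s..t}. ennreal (2 * c * M r) \<partial>lborel) = ennreal (2 * c * (LINT r:{s..t}|lborel. M r))"
  proof -
    have "(\<integral>\<^sup>+ r\<in>{s..t}. ennreal (2 * c * M r) \<partial>lborel) = (\<integral>\<^sup>+ r. ennreal (2 * c * (indicator {s..t} r * M r)) \<partial>lborel)"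
      by (intro nn_integral_cong) (auto simp: indicator_def)
    also have "\<dots> = ennreal (LINT r|lborel. 2 * c * (indicator {s..t} r * M r))"
      using set_integrable_lborel[OF M(1), of "{s..t}"] M(2) c(1)
      by (intro nn_integral_eq_integral) (auto simp: set_integrable_def)
    finally show ?thesis by (simp add: set_lebesgue_integral_def)
  qed
  have k: "ennreal (2 * c * M r) < (ennreal (M r))\<^sup>2 + (k r)\<^sup>2" if "s < r" "r < t" for r
    using ennreal_young_strict[OF M(2) c(1), of "k r"] c(2)[OF that] that st by (simp add: k_def)
  have "(\<integral>\<^sup>+ r\<in>{s..t}. ennreal (2 * c * M r) \<partial>lborel) < (\<integral>\<^sup>+ r\<in>{s..t}. (ennreal (M r))\<^sup>2 + (k r)\<^sup>2 \<partial>lborel)"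
  proof (rule nn_integral_less)
    show "AE r in lborel. ennreal (2 * c * M r) * indicator {s..t} r
            \<le> ((ennreal (M r))\<^sup>2 + (k r)\<^sup>2) * indicator {s..t} r"
      using AE_lborel_singleton[of s] AE_lborel_singleton[of t]
      by eventually_elim (use k in \<open>auto simp: indicator_def intro: less_imp_le\<close>)
    \<comment> \<open>The pointwise strict inequality holds on all of \<open>{s<..<t}\<close>, a set
      of positive measure; this is what carries strictness over to the integrals.\<close>
    show "\<not> (AE r in lborel. ((ennreal (M r))\<^sup>2 + (k r)\<^sup>2) * indicator {s..t} r
            \<le> ennreal (2 * c * M r) * indicator {s..t} r)"
    proof
      assume "AE r in lborel. ((ennreal (M r))\<^sup>2 + (k r)\<^sup>2) * indicator {s..t} r
            \<le> ennreal (2 * c * M r) * indicator {s..t} r"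
      then have "AE r in lborel. r \<notin> {s<..<t}"
        by eventually_elim (use k in \<open>force simp: indicator_def not_le\<close>)
      then have "emeasure lborel {s<..<t} = 0"
        by (subst (asm) AE_iff_measurable[of "{s<..<t}"]) auto
      then show False using st by simp
    qed
    show "(\<integral>\<^sup>+ r\<in>{s..t}. ennreal (2 * c * M r) \<partial>lborel) \<noteq> \<infinity>"
      unfolding I by simp
  qed measurable
  then have "ennreal (2 * c * (LINT r:{s..t}|lborel. M r)) < ennreal (2 * D)"
    using AB \<open>?A + ?B = _\<close> I by auto
  then have "2 * c * (LINT r:{s..t}|lborel. M r) < 2 * D"
    using \<open>D \<ge> 0\<close> by (metis ennreal_leI not_less)
  then show "c * dist (v t) (v s) < real_of_ereal (\<Phi> (v s)) - real_of_ereal (\<Phi> (v t))"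
    using mult_left_mono[OF M(3) c(1)] by (simp add: D_def)
  have "ennreal (c\<^sup>2 * (t - s)) = (\<integral>\<^sup>+ r\<in>{s..t}. ennreal (c\<^sup>2) \<partial>lborel)"
    using st by (simp add: nn_integral_cmult_indicator ennreal_mult)
  also have "\<dots> \<le> ?B"
  proof (rule nn_integral_mono_AE)
    have le: "(ennreal c)\<^sup>2 \<le> (g (v r))\<^sup>2" if "s < r" "r < t" for r
      using c(2)[OF that] by (intro power_mono) auto
    show "AE r in lborel. ennreal (c\<^sup>2) * indicator {s..t} r \<le> (g (v r))\<^sup>2 * indicator {s..t} r"
      using AE_lborel_singleton[of s] AE_lborel_singleton[of t]
      by eventually_elim (use le c(1) in \<open>auto simp: indicator_def ennreal_power\<close>)
  qed
  also have "\<dots> \<le> ?A + ?B" by simp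
  also note AB
  finally show "c\<^sup>2 * (t - s) \<le> 2 * (real_of_ereal (\<Phi> (v s)) - real_of_ereal (\<Phi> (v t)))"
    using \<open>D \<ge> 0\<close> by (simp add: D_def)
qed

text \<open>By Young and the energy inequality, \<open>g\<close> times the speed has finite integral
  over \<open>{a..a + 1}\<close>. The upper gradient bound then dominates the increments of
  \<open>\<Phi>\<close> from \<open>a\<close> by those of a continuous primitive.\<close>

lemma gradient_flow_functional_at_right:
  assumes \<Phi>: "proper_functional \<Phi>" and g: "upper_gradient \<Phi> g" and v: "gradient_flow \<Phi> g v" and "0 < a"
  shows "((\<lambda>t. real_of_ereal (\<Phi> (v t))) \<longlongrightarrow> real_of_ereal (\<Phi> (v a))) (at_right a)"
proof -
  let ?b = "a + 1"
  have ac: "locally_ac_curve v" and dom: "\<forall>t>0. v t \<in> eff_dom \<Phi>"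
    using v by (simp_all add: gradient_flow_def)
  obtain M where M: "integrable lborel M" "\<And>r. 0 \<le> M r"
    "AE r in lborel. r \<in> {a..?b} \<longrightarrow> metric_deriv v r = M r"
    using locally_ac_curve_metric_deriv[OF ac \<open>0 < a\<close>, of ?b] by (metis less_add_one less_imp_le)
  have [measurable]: "M \<in> borel_measurable borel" using M(1) by simp
  define k where "k = (\<lambda>r. g (v r) * indicator {0<..} r)"
  have [measurable]: "k \<in> borel_measurable borel"
    unfolding k_def by (rule upper_gradient_measurable[OF g v])
  define f where "f = (\<lambda>r. k r * ennreal (M r) * indicator {a..?b} r)"
  have [measurable]: "f \<in> borel_measurable borel" unfolding f_def by measurable
  let ?A = "\<integral>\<^sup>+ r\<in>{a..?b}. (ennreal (metric_deriv v r))\<^sup>2 \<partial>lborel"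
  let ?B = "\<integral>\<^sup>+ r\<in>{a..?b}. (g (v r))\<^sup>2 \<partial>lborel"
  have A: "?A = (\<integral>\<^sup>+ r\<in>{a..?b}. (ennreal (M r))\<^sup>2 \<partial>lborel)"
    using M(3) by (intro nn_integral_cong_AE) (auto simp: indicator_def elim!: eventually_mono)
  have B: "?B = (\<integral>\<^sup>+ r\<in>{a..?b}. (k r)\<^sup>2 \<partial>lborel)"
    using \<open>0 < a\<close> by (intro nn_integral_cong) (auto simp: indicator_def k_def)
  have "2 * (\<integral>\<^sup>+ r. f r \<partial>lborel) = (\<integral>\<^sup>+ r. 2 * f r \<partial>lborel)"
    by (subst nn_integral_cmult) auto
  also have "\<dots> \<le> (\<integral>\<^sup>+ r\<in>{a..?b}. (ennreal (M r))\<^sup>2 + (k r)\<^sup>2 \<partial>lborel)"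
    by (intro nn_integral_mono) (auto simp: f_def indicator_def mult.commute[of "k _"] ennreal_young)
  also have "\<dots> = ?A + ?B"
    unfolding A B by (subst nn_integral_add[symmetric]) (auto simp: distrib_right)
  also have "\<dots> \<le> ennreal (2 * (real_of_ereal (\<Phi> (v a)) - real_of_ereal (\<Phi> (v ?b))))"
    by (rule gradient_flow_energy(2)[OF \<Phi> v \<open>0 < a\<close>]) simp
  also have "\<dots> < \<infinity>" by simp
  finally have fin: "(\<integral>\<^sup>+ r. f r \<partial>lborel) < \<infinity>"
    by (auto simp: ennreal_mult_less_top)
  then have fAE: "AE r in lborel. f r \<noteq> \<infinity>"
    by (intro nn_integral_PInf_AE) auto
  define q where "q = (\<lambda>r. enn2real (f r))"
  have qf: "AE r in lborel. ennreal (q r) = f r"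
    using fAE by eventually_elim (auto simp: q_def less_top)
  have "(\<integral>\<^sup>+ r. ennreal (q r) \<partial>lborel) = (\<integral>\<^sup>+ r. f r \<partial>lborel)"
    using qf by (intro nn_integral_cong_AE) auto
  then have q: "integrable lborel q"
    using fin unfolding q_def by (intro integrableI_nonneg) auto
  have "dist (real_of_ereal (\<Phi> (v t))) (real_of_ereal (\<Phi> (v a))) \<le> (LINT r:{a..t}|lborel. q r)"
    if t: "a \<le> t" "t \<le> ?b" for t
  proof -
    have "0 < t" using \<open>0 < a\<close> t by simp
    obtain x y where xy: "\<Phi> (v t) = ereal x" "\<Phi> (v a) = ereal y"
      using gradient_flow_finite[OF \<Phi> v \<open>0 < t\<close>] gradient_flow_finite[OF \<Phi> v \<open>0 < a\<close>]
      by (metis abs_neq_infinity_cases)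
    have "(\<integral>\<^sup>+ r\<in>{a..t}. g (v r) * ennreal (metric_deriv v r) \<partial>lborel)
            = (\<integral>\<^sup>+ r. ennreal (indicator {a..t} r * q r) \<partial>lborel)"
    proof (rule nn_integral_cong_AE)
      show "AE r in lborel. g (v r) * ennreal (metric_deriv v r) * indicator {a..t} r
              = ennreal (indicator {a..t} r * q r)"
        using M(3) qf
        by eventually_elim (use t \<open>0 < a\<close> in \<open>auto simp: indicator_def f_def k_def\<close>)
    qed
    also have "\<dots> = ennreal (LINT r:{a..t}|lborel. q r)"
      using set_integrable_lborel[OF q, of "{a..t}"]
      by (subst nn_integral_eq_integral) (auto simp: set_integrable_def set_lebesgue_integral_def q_def)
    finally have I: "(\<integral>\<^sup>+ r\<in>{a..t}. g (v r) * ennreal (metric_deriv v r) \<partial>lborel)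
            = ennreal (LINT r:{a..t}|lborel. q r)" .
    have "0 \<le> (LINT r:{a..t}|lborel. q r)"
      unfolding set_lebesgue_integral_def by (intro integral_nonneg_AE) (auto simp: q_def)
    moreover have "\<bar>\<Phi> (v t) - \<Phi> (v a)\<bar>
        \<le> enn2ereal (\<integral>\<^sup>+ r\<in>{a..t}. g (v r) * ennreal (metric_deriv v r) \<partial>lborel)"
      using g[unfolded upper_gradient_def, rule_format, OF ac] dom \<open>0 < a\<close> t by blast
    ultimately show ?thesis
      unfolding I xy by (simp add: enn2ereal_ennreal dist_real_def)
  qed
  then show ?thesis
    using q by (intro tendsto_at_right_if_dist_le_LINT[of q a ?b]) auto
qed

section \<open>Time translation of gradient flows\<close>

lemma oriented_nn_integral_shift:
  assumes "\<And>s t. 0 < s \<Longrightarrow> s \<le> t \<Longrightarrow> \<exists>F\<in>borel_measurable borel. AE r in lborel. r \<in> {s..t} \<longrightarrow> f r = F r"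
    and a: "0 \<le> a" and st: "0 < s" "0 < t"
  shows "oriented_nn_integral s t (\<lambda>r. f (r + a)) = oriented_nn_integral (s + a) (t + a) f"
proof -
  have "(\<integral>\<^sup>+ r\<in>{s..t}. f (r + a) \<partial>lborel) = (\<integral>\<^sup>+ r\<in>{s + a..t + a}. f r \<partial>lborel)" if s: "0 < s" "s \<le> t" for s t
  proof -
    \<comment> \<open>The change of variables is applied to a Borel integrand, while
      \<open>metric_deriv v\<close> is only known to agree with one almost everywhere on compact
      intervals. So \<open>f\<close> is exchanged for \<open>F\<close>, the exceptional null set is
      translated along, and \<open>f\<close> is restored at the end.\<close>
    obtain F where [measurable]: "F \<in> borel_measurable borel"
      and F: "AE r in lborel. r \<in> {s+a..t+a} \<longrightarrow> f r = F r"
      using assms(1)[of "s + a" "t + a"] s a by auto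
    have "AE r in distr lborel borel ((+) a). r \<in> {s+a..t+a} \<longrightarrow> f r = F r"
      unfolding lborel_distr_plus by (rule F)
    then have F': "AE r in lborel. a + r \<in> {s+a..t+a} \<longrightarrow> f (a + r) = F (a + r)"
      by (rule AE_distrD[rotated]) simp
    have "(\<integral>\<^sup>+ r\<in>{s..t}. f (r + a) \<partial>lborel) = (\<integral>\<^sup>+ r. F (a + 1 * r) * indicator {s+a..t+a} (a + 1 * r) \<partial>lborel)"
      using F' by (intro nn_integral_cong_AE) (auto simp: indicator_def add.commute elim!: eventually_mono)
    also have "\<dots> = (\<integral>\<^sup>+ r. F r * indicator {s+a..t+a} r \<partial>lborel)"
      by (subst nn_integral_real_affine[where c=1 and t=a and f="\<lambda>r. F r * indicator {s+a..t+a} r"]) auto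
    also have "\<dots> = (\<integral>\<^sup>+ r\<in>{s + a..t + a}. f r \<partial>lborel)"
      using F by (intro nn_integral_cong_AE) (auto simp: indicator_def elim!: eventually_mono)
    finally show ?thesis .
  qed
  then show ?thesis using st by (simp add: oriented_nn_integral_def)
qed

lemma metric_deriv_shift: "metric_deriv (\<lambda>t. v (t + a)) t = metric_deriv v (t + a)"
  by (simp add: metric_deriv_def ac_simps)

lemma locally_ac_curve_shift:
  assumes "locally_ac_curve v" "0 \<le> a"
  shows "locally_ac_curve (\<lambda>t. v (t + a))"
proof -
  obtain m where m: "\<And>r. r > 0 \<Longrightarrow> 0 \<le> m r"
    "\<And>s t. 0 < s \<Longrightarrow> s \<le> t \<Longrightarrow> set_integrable lborel {s..t} m"
    "\<And>s t. 0 < s \<Longrightarrow> s \<le> t \<Longrightarrow> dist (v t) (v s) \<le> (LINT r:{s..t}|lborel. m r)"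
    using assms(1) unfolding locally_ac_curve_def by blast
  have ind: "indicator {s + a..t + a} (a + 1 * r) * m (a + 1 * r) = indicator {s..t} r * m (r + a)" for s t r
    by (auto simp: indicator_def add.commute)
  have "set_integrable lborel {s..t} (\<lambda>r. m (r + a))" if "0 < s" "s \<le> t" for s t
    using lborel_integrable_real_affine[where f="\<lambda>r. indicator {s+a..t+a} r * m r" and c=1 and t=a]
      m(2)[of "s + a" "t + a"] that assms(2) unfolding ind by (simp add: set_integrable_def)
  moreover have "(LINT r:{s..t}|lborel. m (r + a)) = (LINT r:{s+a..t+a}|lborel. m r)" for s t
    using lborel_integral_real_affine[where f="\<lambda>r. indicator {s+a..t+a} r * m r" and c=1 and t=a]
    unfolding ind by (simp add: set_lebesgue_integral_def)
  ultimately show ?thesis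
    unfolding locally_ac_curve_def using m assms(2)
    by (intro exI[of _ "\<lambda>r. m (r + a)"]) auto
qed

lemma gradient_flow_shift:
  assumes g: "upper_gradient \<Phi> g" and v: "gradient_flow \<Phi> g v" and a: "0 \<le> a"
  shows "gradient_flow \<Phi> g (\<lambda>t. v (t + a))"
proof -
  have ac: "locally_ac_curve v" using v by (simp add: gradient_flow_def)
  have FA: "\<exists>F\<in>borel_measurable borel. AE r in lborel. r \<in> {s..t} \<longrightarrow> (ennreal (metric_deriv v r))\<^sup>2 = F r"
    if st: "0 < s" "s \<le> t" for s t
  proof -
    obtain M where M: "integrable lborel M" "AE r in lborel. r \<in> {s..t} \<longrightarrow> metric_deriv v r = M r"
      by (rule locally_ac_curve_metric_deriv[OF ac st]) (rule that; assumption)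
    then show ?thesis
      by (intro bexI[of _ "\<lambda>r. (ennreal (M r))\<^sup>2"]) (auto elim!: eventually_mono)
  qed
  have A: "oriented_nn_integral s t (\<lambda>r. (ennreal (metric_deriv v (r + a)))\<^sup>2)
      = oriented_nn_integral (s + a) (t + a) (\<lambda>r. (ennreal (metric_deriv v r))\<^sup>2)"
    if "0 < s" "0 < t" for s t
    by (rule oriented_nn_integral_shift[OF _ a that]) (rule FA)
  have FB: "\<exists>F\<in>borel_measurable borel. AE r in lborel. r \<in> {s..t} \<longrightarrow> (g (v r))\<^sup>2 = F r"
    if st: "0 < s" "s \<le> t" for s t
    using upper_gradient_measurable[OF g v] st
    by (intro bexI[of _ "\<lambda>r. (g (v r) * indicator {0<..} r)\<^sup>2"]) auto
  have B: "oriented_nn_integral s t (\<lambda>r. (g (v (r + a)))\<^sup>2)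
      = oriented_nn_integral (s + a) (t + a) (\<lambda>r. (g (v r))\<^sup>2)"
    if "0 < s" "0 < t" for s t
    by (rule oriented_nn_integral_shift[OF _ a that]) (rule FB)
  show ?thesis
    unfolding gradient_flow_def
  proof (intro conjI allI impI)
    show "locally_ac_curve (\<lambda>t. v (t + a))" by (rule locally_ac_curve_shift[OF ac a])
    show "v (t + a) \<in> eff_dom \<Phi>" if "0 < t" for t
      using v a that by (simp add: gradient_flow_def)
    fix s t :: real assume st: "0 < s" "0 < t"
    then have "0 < s + a" "0 < t + a" using a by auto
    then show "\<Phi> (v (t + a)) - \<Phi> (v (s + a))
        \<le> - (ereal (1/2) * oriented_nn_integral s t (\<lambda>r. (ennreal (metric_deriv (\<lambda>t. v (t + a)) r))\<^sup>2))
           - ereal (1/2) * oriented_nn_integral s t (\<lambda>r. (g (v (r + a)))\<^sup>2)"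
      unfolding metric_deriv_shift A[OF st] B[OF st] using v unfolding gradient_flow_def by blast
  qed
qed

text \<open>For the tail \<open>\<lambda>t. v (t + a)\<close>, the two required limits at 0 are the
  right limits at \<open>a\<close> of \<open>v\<close> and of \<open>\<Phi>\<close> along
  \<open>v\<close>.\<close>

lemma gradient_flow_point_in_flow_starts:
  assumes \<Phi>: "proper_functional \<Phi>" and g: "upper_gradient \<Phi> g" and v: "gradient_flow \<Phi> g v" and a: "0 < a"
  shows "v a \<in> flow_starts \<Phi> g"
proof -
  have ac: "locally_ac_curve v" and dom: "\<forall>t>0. v t \<in> eff_dom \<Phi>"
    using v by (simp_all add: gradient_flow_def)
  have "\<forall>\<^sub>F t in at_right a. ereal (real_of_ereal (\<Phi> (v t))) = \<Phi> (v t)"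
    using eventually_at_right_less[of a]
    by eventually_elim (use gradient_flow_finite[OF \<Phi> v] a in \<open>simp add: ereal_real'\<close>)
  moreover have "ereal (real_of_ereal (\<Phi> (v a))) = \<Phi> (v a)"
    using gradient_flow_finite[OF \<Phi> v a] by (simp add: ereal_real')
  ultimately have "((\<lambda>t. \<Phi> (v t)) \<longlongrightarrow> \<Phi> (v a)) (at_right a)"
    using tendsto_ereal[OF gradient_flow_functional_at_right[OF \<Phi> g v a]]
    by (auto intro: Lim_transform_eventually)
  then have "((\<lambda>t. \<Phi> (v (t + a))) \<longlongrightarrow> \<Phi> (v a)) (at_right 0)"
    by (subst (asm) filterlim_at_right_to_0)
  moreover have "((\<lambda>t. v (t + a)) \<longlongrightarrow> v a) (at_right 0)"
    using locally_ac_curve_tendsto_at_right[OF ac a] by (subst (asm) filterlim_at_right_to_0)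
  ultimately show ?thesis
    unfolding flow_starts_def using gradient_flow_shift[OF g v, of a] a dom by auto
qed

section \<open>Reaching small slope along the flow from \<open>u\<close>\<close>

theorem theorem2p8:
  fixes \<Phi> :: "'a::metric_space \<Rightarrow> ereal" and g :: "'a \<Rightarrow> ennreal"
    and u :: 'a and \<epsilon> lam :: real
  assumes "proper_functional \<Phi>"
    and "bounded_from_below \<Phi>"
    and "upper_gradient \<Phi> g"
    and "flow_starts \<Phi> g \<noteq> {}"
    and "u \<in> flow_starts \<Phi> g"
    and "\<epsilon> > 0"
    and "\<Phi> u \<le> (INF x. \<Phi> x) + ereal \<epsilon>"
    and "g u \<le> Liminf (at u) g"
    and "lam > 0"
  shows "\<exists>w \<in> flow_starts \<Phi> g.
           dist u w \<le> lam \<and>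
           \<Phi> w + ereal (\<epsilon> / lam * dist u w) \<le> \<Phi> u \<and>
           g w \<le> ennreal (\<epsilon> / lam)"
proof (cases "g u \<le> ennreal (\<epsilon> / lam)")
  case True
  then show ?thesis using assms(5,9) by (intro bexI[of _ u]) (auto simp: zero_ereal_def[symmetric])
next
  case False
  define c where "c = \<epsilon> / lam"
  have "c > 0" using assms by (simp add: c_def)
  have gu: "ennreal c < g u" using False by (simp add: c_def)
  note \<Phi> = assms(1) and ug = assms(3)
  obtain v where v: "gradient_flow \<Phi> g v" and vu: "(v \<longlongrightarrow> u) (at_right 0)"
    and \<Phi>u: "((\<lambda>t. \<Phi> (v t)) \<longlongrightarrow> \<Phi> u) (at_right 0)" and "\<Phi> u < \<infinity>"
    using assms(5) by (auto simp: flow_starts_def eff_dom_def)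
  then obtain x where x: "\<Phi> u = ereal x"
    using \<Phi> by (cases "\<Phi> u") (auto simp: proper_functional_def)
  define \<phi> where "\<phi> t = real_of_ereal (\<Phi> (v t))" for t
  have \<phi>: "\<Phi> (v t) = ereal (\<phi> t)" if "t > 0" for t
    using gradient_flow_finite[OF \<Phi> v that] by (simp add: \<phi>_def ereal_real')
  have \<phi>_mono: "\<phi> t \<le> \<phi> s" if "0 < s" "s \<le> t" for s t
    unfolding \<phi>_def using gradient_flow_energy(1)[OF \<Phi> v that] .
  note slope = gradient_flow_slope[OF \<Phi> ug v, of _ _ c, folded \<phi>_def]
  have "((\<lambda>t. ereal (\<phi> t)) \<longlongrightarrow> ereal x) (at_right 0)"
    using \<Phi>u unfolding x
    by (rule Lim_transform_eventually) (use eventually_at_right_less[of 0] \<phi> in \<open>auto elim!: eventually_mono\<close>)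
  then have \<phi>x: "(\<phi> \<longlongrightarrow> x) (at_right 0)" by simp

  have "\<forall>\<^sub>F y in at u. ennreal c < g y"
    using gu assms(8) by (intro less_LiminfD) auto
  \<comment> \<open>The lower limit sees punctured neighbourhoods only; \<open>gu\<close> adds the
    point \<open>u\<close> itself, which the flow may occupy at positive times.\<close>
  then have "\<forall>\<^sub>F y in nhds u. ennreal c < g y"
    using gu by (auto simp: eventually_at_filter elim!: eventually_mono)
  then have "\<forall>\<^sub>F t in at_right 0. ennreal c < g (v t)"
    using vu by (rule eventually_compose_filterlim)
  then obtain d where d: "0 < d" "\<And>t. 0 < t \<Longrightarrow> t < d \<Longrightarrow> ennreal c < g (v t)"
    unfolding eventually_at_right_field by auto
  define S where "S = {t. 0 < t \<and> g (v t) \<le> ennreal c}"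
  have "S \<noteq> {}"
  proof
    assume "S = {}"
    then have gc: "ennreal c < g (v t)" if "0 < t" for t
      using that by (auto simp: S_def not_le[symmetric])
    obtain b where b: "\<And>y. ereal b \<le> \<Phi> y"
      using assms(2) by (auto simp: bounded_from_below_def)
    \<comment> \<open>Chosen so that \<open>c\<^sup>2 * (t - 1)\<close> exceeds by one the bound
      \<open>2 * (\<phi> 1 - b)\<close> on twice the energy drop after time 1.\<close>
    define t where "t = 1 + (2 * (\<phi> 1 - b) + 1) / c\<^sup>2"
    have "b \<le> \<phi> 1" using b[of "v 1"] \<phi>[of 1] by simp
    then have "1 < t" using \<open>c > 0\<close> by (simp add: t_def add_nonneg_pos)
    then have "c\<^sup>2 * (t - 1) \<le> 2 * (\<phi> 1 - \<phi> t)"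
      using \<open>c > 0\<close> gc by (intro slope(2)) auto
    moreover have "c\<^sup>2 * (t - 1) = 2 * (\<phi> 1 - b) + 1"
      using \<open>c > 0\<close> by (simp add: t_def)
    moreover have "b \<le> \<phi> t" using b[of "v t"] \<phi>[of t] \<open>1 < t\<close> by simp
    ultimately show False by simp
  qed
  define T where "T = Inf S"
  have "bdd_below S" by (auto simp: S_def intro!: bdd_belowI[of _ 0])
  have "d \<le> T"
    unfolding T_def using \<open>S \<noteq> {}\<close> d(2) by (intro cInf_greatest) (auto simp: S_def not_le[symmetric])
  then have "0 < T" using d(1) by simp
  have gT: "ennreal c < g (v r)" if "0 < r" "r < T" for r
  proof (rule ccontr)
    assume "\<not> ?thesis"
    then have "T \<le> r"
      unfolding T_def using that \<open>bdd_below S\<close> by (intro cInf_lower) (auto simp: S_def)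
    then show False using that by simp
  qed
  \<comment> \<open>Letting the starting time tend to 0 would turn a strict inequality into a weak
    one. The surplus \<open>\<delta>\<close> gained on \<open>{T/2..T}\<close> is independent of the
    starting time and so survives the limit.\<close>
  define \<delta> where "\<delta> = \<phi> (T/2) - \<phi> T - c * dist (v T) (v (T/2))"
  have "0 < \<delta>"
    unfolding \<delta>_def using slope(1)[of "T/2" T] \<open>0 < T\<close> \<open>c > 0\<close> gT by simp
  have "\<forall>\<^sub>F s in at_right 0. \<phi> T + c * dist (v T) (v s) + \<delta> \<le> \<phi> s"
    using eventually_at_right_real[OF half_gt_zero[OF \<open>0 < T\<close>]]
  proof eventually_elim
    case (elim s)
    then have "c * dist (v (T/2)) (v s) < \<phi> s - \<phi> (T/2)"
      using \<open>c > 0\<close> gT by (intro slope(1)) auto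
    moreover have "c * dist (v T) (v s) \<le> c * dist (v T) (v (T/2)) + c * dist (v (T/2)) (v s)"
      using \<open>c > 0\<close> dist_triangle[of "v T" "v s" "v (T/2)"] by (simp add: distrib_left[symmetric])
    ultimately show ?case by (simp add: \<delta>_def)
  qed
  then have "\<phi> T + c * dist (v T) u + \<delta> \<le> x"
    by (rule tendsto_le[OF trivial_limit_at_right_real \<phi>x, rotated]) (intro tendsto_intros vu)
  then have gap: "\<phi> T + c * dist u (v T) < x"
    using \<open>0 < \<delta>\<close> by (simp add: dist_commute)
  \<comment> \<open>The energy is held at \<open>\<phi> T\<close>: after \<open>T\<close> it can
    only decrease, so near \<open>T\<close> just the distance term has to be controlled.\<close>
  have "((\<lambda>t. \<phi> T + c * dist u (v t)) \<longlongrightarrow> \<phi> T + c * dist u (v T)) (at_right T)"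
    using v \<open>0 < T\<close>
    by (intro tendsto_intros locally_ac_curve_tendsto_at_right) (auto simp: gradient_flow_def)
  then have "\<forall>\<^sub>F t in at_right T. \<phi> T + c * dist u (v t) < x"
    using gap by (rule order_tendstoD(2))
  then obtain b where b: "T < b" "\<And>t. T < t \<Longrightarrow> t < b \<Longrightarrow> \<phi> T + c * dist u (v t) < x"
    unfolding eventually_at_right_field by auto
  obtain t where t: "t \<in> S" "t < b"
    using \<open>S \<noteq> {}\<close> b(1) unfolding T_def by (metis cInf_lessD)
  have "T \<le> t" unfolding T_def using \<open>bdd_below S\<close> t(1) by (intro cInf_lower)
  have "0 < t" using t(1) by (simp add: S_def)
  \<comment> \<open>If the infimum is attained, \<open>t\<close> may be \<open>T\<close> itself,
    where \<open>gap\<close> applies directly.\<close>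
  have "\<phi> T + c * dist u (v t) < x"
    using b(2)[of t] t(2) gap \<open>T \<le> t\<close> by (cases "t = T") auto
  then have le: "\<phi> t + c * dist u (v t) \<le> x"
    using \<phi>_mono[OF \<open>0 < T\<close> \<open>T \<le> t\<close>] by simp
  \<comment> \<open>Near-minimality of \<open>u\<close> limits the energy drop to
    \<open>\<epsilon>\<close>, and \<open>le\<close> says that the drop pays for
    \<open>c * dist u (v t)\<close>. With \<open>c = \<epsilon> / lam\<close> this yields the bound
    \<open>lam\<close> on the distance.\<close>
  have "\<Phi> u \<le> \<Phi> (v t) + ereal \<epsilon>"
    using assms(7) by (rule order_trans) (intro add_right_mono INF_lower UNIV_I)
  then have "c * dist u (v t) \<le> \<epsilon>"
    using le \<phi>[OF \<open>0 < t\<close>] x by simp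
  then have "dist u (v t) \<le> lam"
    using assms(6,9) by (simp add: c_def field_simps)
  then show ?thesis
    using gradient_flow_point_in_flow_starts[OF \<Phi> ug v \<open>0 < t\<close>] le \<phi>[OF \<open>0 < t\<close>] x t(1)
    by (intro bexI[of _ "v t"]) (auto simp: c_def S_def)
qed

end
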